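(* For online multi-coloring of an arbitrary graph, there is a strictly $1$-competitive online algorithm with advice whose advice complexity is at most $(n+1)\lceil\log\mathrm{Opt}\rceil$, where $n$ is the number of requests.
   Context: Online multi-coloring: the graph is known in advance; requests arrive one at a time, each naming a node $v$, and must immediately and irrevocably receive a color (positive integer) different from every color previously assigned to $v$ or any neighbor of $v$. $A(I)$ is the number of colors used and $\mathrm{Opt}=\mathrm{Opt}(I)$ the minimum number an offline algorithm needs on $I$. Advice model: an all-powerful oracle knowing $I$ writes an infinite binary advice tape; advice complexity is the maximum index of a bit read. Strictly $1$-competitive means $A(I)\le\mathrm{Opt}(I)$ for all $I$. Logarithms are base 2.
   Formalization: For inputs with Opt = 1 the stated bound is 0, which no strictly 1-competitive algorithm can meet on a path with four nodes (requests 0,3 versus 0,3,1,2); there the theorem allows one bit of advice, and the bound (n+1)⌈log Opt⌉ is kept for all other inputs. *)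

theory Defs
  imports Complex_Main "Graph_Theory.Digraph"
begin

text \<open>
  A request sequence is a list of nodes and a coloring of it is the list of the colors given to
  the successive requests, so that a node receives one color for each of its requests.
\<close>

definition is_multicoloring :: "('v, 'e) pre_digraph \<Rightarrow> 'v list \<Rightarrow> nat list \<Rightarrow> bool" where
  "is_multicoloring G I cs \<longleftrightarrow>
     length cs = length I \<and> (\<forall>c\<in>set cs. 0 < c) \<and>
     (\<forall>j<length I. \<forall>i<j. I ! i = I ! j \<or> I ! i \<rightarrow>\<^bsub>G\<^esub> I ! j \<longrightarrow> cs ! i \<noteq> cs ! j)"

definition Opt :: "('v, 'e) pre_digraph \<Rightarrow> 'v list \<Rightarrow> nat" where
  "Opt G I = (LEAST k. \<exists>cs. is_multicoloring G I cs \<and> card (set cs) = k)"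

text \<open>
  The computation done for one request: query finitely many cells of the advice tape, each chosen
  in dependence on the bits seen so far, then assign a color. The type is coinductive because a
  computation (such as reading a number in unary) need not end on tapes that the oracle never writes.
\<close>

codatatype computation = Assign nat | Query nat "bool \<Rightarrow> computation"

type_synonym tape = "nat \<Rightarrow> bool"

text \<open>
  Tape cells are numbered from 1 when bits read are recorded, so that the maximum index of a bit
  read is also the length of the tape prefix used: \<open>Query i\<close> reads the bit with index \<open>Suc i\<close>.
\<close>

inductive computes :: "tape \<Rightarrow> computation \<Rightarrow> nat \<Rightarrow> nat set \<Rightarrow> bool" for \<phi> where
  assign: "computes \<phi> (Assign c) c {}"
| query: "computes \<phi> (f (\<phi> i)) c R \<Longrightarrow> computes \<phi> (Query i f) c (insert (Suc i) R)"

text \<open>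
  The computation for a request may depend on all requests up to and including the current one.
  No memory is needed besides: a state is determined by these requests and the bits read before,
  and reading these bits again does not change the maximum index.
\<close>

type_synonym 'v online_algorithm = "'v list \<Rightarrow> computation"

type_synonym 'v advice_oracle = "'v list \<Rightarrow> tape"

inductive serves :: "'v online_algorithm \<Rightarrow> tape \<Rightarrow> 'v list \<Rightarrow> nat list \<Rightarrow> nat set \<Rightarrow> bool"
  for A \<phi> where
  empty: "serves A \<phi> [] [] {}"
| request: "serves A \<phi> I cs R \<Longrightarrow> computes \<phi> (A (I @ [v])) c S \<Longrightarrow>
            serves A \<phi> (I @ [v]) (cs @ [c]) (R \<union> S)"

definition solves_multicoloring ::
  "('v, 'e) pre_digraph \<Rightarrow> 'v online_algorithm \<Rightarrow> 'v advice_oracle \<Rightarrow> bool" where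
  "solves_multicoloring G A \<Omega> \<longleftrightarrow>
     (\<forall>I. set I \<subseteq> verts G \<longrightarrow> (\<exists>cs R. serves A (\<Omega> I) I cs R \<and> is_multicoloring G I cs))"

definition strictly_competitive ::
  "real \<Rightarrow> ('v, 'e) pre_digraph \<Rightarrow> 'v online_algorithm \<Rightarrow> 'v advice_oracle \<Rightarrow> bool" where
  "strictly_competitive \<rho> G A \<Omega> \<longleftrightarrow>
     (\<forall>I cs R. set I \<subseteq> verts G \<longrightarrow> serves A (\<Omega> I) I cs R \<longrightarrow>
        real (card (set cs)) \<le> \<rho> * real (Opt G I))"

definition max_index :: "nat set \<Rightarrow> nat" where
  "max_index R = Max (insert 0 R)"

lemma computes_deterministic:
  "computes \<phi> p c R \<Longrightarrow> computes \<phi> p c' R' \<Longrightarrow> c' = c \<and> R' = R"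
proof (induction arbitrary: c' R' rule: computes.induct)
  case (assign c)
  then show ?case by (auto elim: computes.cases)
next
  case (query f i c R)
  from query.prems show ?case by (cases rule: computes.cases) (use query.IH in auto)
qed

lemma serves_deterministic:
  "serves A \<phi> I cs R \<Longrightarrow> serves A \<phi> I cs' R' \<Longrightarrow> cs' = cs \<and> R' = R"
proof (induction arbitrary: cs' R' rule: serves.induct)
  case empty
  then show ?case by (auto elim: serves.cases)
next
  case (request I cs R v c S)
  from request.prems obtain cs0 R0 c0 S0
    where "serves A \<phi> I cs0 R0" "computes \<phi> (A (I @ [v])) c0 S0"
      "cs' = cs0 @ [c0]" "R' = R0 \<union> S0"
    by (cases rule: serves.cases) auto
  then show ?case using request computes_deterministic by blast
qed

lemma finite_computes: "computes \<phi> p c R \<Longrightarrow> finite R"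
  by (induction rule: computes.induct) auto

lemma finite_serves: "serves A \<phi> I cs R \<Longrightarrow> finite R"
  by (induction rule: serves.induct) (auto intro: finite_computes)

text \<open>
  The bound \<open>(n + 1) \<lceil>log Opt\<rceil>\<close> is 0 if \<open>Opt = 1\<close>, and it cannot be met there in general. On a path
  with nodes 0, 1, 2, 3, requests to 0 and 3 would have to be given the same color without any
  advice, and if requests to 1 and 2 follow, two colors no longer suffice. This is why the case
  \<open>Opt = 1\<close> is granted a single bit of advice.
\<close>

definition path4 :: "(nat, nat \<times> nat) pre_digraph" where
  "path4 = \<lparr>verts = {..<4}, arcs = {(0,1),(1,0),(1,2),(2,1),(2,3),(3,2)}, tail = fst, head = snd\<rparr>"

lemma graph_path4: "graph path4"
  by unfold_locales (auto simp: path4_def arc_to_ends_def arcs_ends_def symmetric_def sym_def)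

lemma dominates_path4:
  "u \<rightarrow>\<^bsub>path4\<^esub> v \<longleftrightarrow> (u, v) \<in> {(0,1),(1,0),(1,2),(2,1),(2,3),(3,2)}"
  by (auto simp: path4_def arc_to_ends_def arcs_ends_def)

lemma Opt_le: "is_multicoloring G I cs \<Longrightarrow> Opt G I \<le> card (set cs)"
  unfolding Opt_def by (rule Least_le) blast

lemma Opt_attained: "\<exists>cs. is_multicoloring G I cs \<and> card (set cs) = Opt G I"
proof -
  have "is_multicoloring G I (map Suc [0..<length I])"
    by (auto simp: is_multicoloring_def)
  then have "\<exists>k cs. is_multicoloring G I cs \<and> card (set cs) = k" by blast
  then show ?thesis unfolding Opt_def by (rule LeastI_ex)
qed

lemma no_advice_if_Opt_1_impossible:
  assumes solves: "solves_multicoloring path4 A \<Omega>" and comp: "strictly_competitive 1 path4 A \<Omega>"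
    and bound: "\<And>I cs R. set I \<subseteq> verts path4 \<Longrightarrow> serves A (\<Omega> I) I cs R \<Longrightarrow> Opt path4 I = 1 \<Longrightarrow>
      max_index R = 0"
  shows False
proof -
  have mc1: "is_multicoloring path4 [0,3] [1,1]"
    by (auto simp: is_multicoloring_def dominates_path4 less_Suc_eq)
  have mc2: "is_multicoloring path4 [0,3,1,2] [1,2,2,1]"
    by (auto simp: is_multicoloring_def dominates_path4 less_Suc_eq nth_Cons')
  obtain ds where ds: "is_multicoloring path4 [0,3] ds" "card (set ds) = Opt path4 [0,3]"
    using Opt_attained by blast
  have "ds \<noteq> []" using ds(1) by (auto simp: is_multicoloring_def)
  then have "card (set ds) > 0" by (simp add: card_gt_0_iff)
  with ds(2) Opt_le[OF mc1] have opt1: "Opt path4 [0,3] = 1" by simp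
  have opt2: "Opt path4 [0,3,1,2] \<le> 2" using Opt_le[OF mc2] by (simp add: insert_commute)
  have V: "set [0,3] \<subseteq> verts path4" "set [0,3,1,2] \<subseteq> verts path4" by (auto simp: path4_def)
  obtain cs R where r: "serves A (\<Omega> [0,3]) [0,3] cs R" using solves V
    unfolding solves_multicoloring_def by meson
  have "max_index R = 0" using bound[OF V(1) r opt1] .
  moreover have "0 \<notin> R"
  proof -
    have *: "0 \<notin> S" if "computes \<phi> p c S" for \<phi> p c S
      using that by (induction rule: computes.induct) auto
    have "0 \<notin> S" if "serves B \<phi> J c S" for B :: "nat online_algorithm" and \<phi> J c S
      using that by (induction rule: serves.induct) (auto dest: *)
    then show ?thesis using r by blast
  qed
  ultimately have R: "R = {}" using finite_serves[OF r] unfolding max_index_def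
    by (metis Max_ge finite_insert insertCI le_zero_eq all_not_in_conv)
  have snoc: "\<exists>cs0 R0 c S. serves B \<phi> I cs0 R0 \<and> computes \<phi> (B (I @ [v])) c S \<and> ds = cs0 @ [c] \<and> T = R0 \<union> S"
    if "serves B \<phi> (I @ [v]) ds T" for B :: "nat online_algorithm" and \<phi> I v ds T
    using that by (cases rule: serves.cases) auto
  have emp: "p = Assign c" if "computes \<phi> p c {}" for \<phi> p c
    using that by (cases rule: computes.cases) auto
  have nil: "ds = []" if "serves B \<phi> [] ds T" for B :: "nat online_algorithm" and \<phi> ds T
    using that by (cases rule: serves.cases) auto
  obtain c3 cs1 where c3: "computes (\<Omega> [0,3]) (A [0,3]) c3 {}" "serves A (\<Omega> [0,3]) [0] cs1 {}"
      "cs = cs1 @ [c3]"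
    using snoc[of A "\<Omega> [0,3]" "[0]" 3 cs R] r R by auto
  obtain c0 where c0: "computes (\<Omega> [0,3]) (A [0]) c0 {}" "cs1 = [c0]"
    using snoc[of A "\<Omega> [0,3]" "[]" 0 cs1 "{}"] c3(2) nil by fastforce
  have A: "A [0] = Assign c0" "A [0,3] = Assign c3" using emp c0 c3 by blast+
  have "card {c0, c3} \<le> 1"
    using comp V(1) r opt1 unfolding strictly_competitive_def c3 c0 by fastforce
  then have eq: "c0 = c3" by (auto simp: card_insert_if split: if_splits)
  let ?I = "[0,3,1,2] :: nat list"
  obtain es T where s: "serves A (\<Omega> ?I) ?I es T" "is_multicoloring path4 ?I es"
    using solves V unfolding solves_multicoloring_def by meson
  obtain es3 T3 e4 where s3: "serves A (\<Omega> ?I) [0,3,1] es3 T3" "es = es3 @ [e4]"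
    using snoc[of A "\<Omega> ?I" "[0,3,1]" 2 es T] s by auto
  obtain es2 T2 e3 where s2: "serves A (\<Omega> ?I) [0,3] es2 T2" "es3 = es2 @ [e3]"
    using snoc[of A "\<Omega> ?I" "[0,3]" 1 es3 T3] s3 by auto
  obtain es1 T1 e2 S where s1: "serves A (\<Omega> ?I) [0] es1 T1" "es2 = es1 @ [e2]"
      "computes (\<Omega> ?I) (A [0,3]) e2 S"
    using snoc[of A "\<Omega> ?I" "[0]" 3 es2 T2] s2 by auto
  obtain e1 S' where s0: "es1 = [e1]" "computes (\<Omega> ?I) (A [0]) e1 S'"
    using snoc[of A "\<Omega> ?I" "[]" 0 es1 T1] s1 nil by fastforce
  have "e1 = c0" "e2 = c0" using s0 s1(3) A eq computes_deterministic computes.assign by metis+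
  then have es: "es = [c0, c0, e3, e4]" using s3 s2 s1 s0 by simp
  have m: "\<And>i j. i < j \<Longrightarrow> j < 4 \<Longrightarrow> ?I ! i \<rightarrow>\<^bsub>path4\<^esub> ?I ! j \<Longrightarrow> es ! i \<noteq> es ! j"
    using s(2) unfolding is_multicoloring_def by auto
  have "c0 \<noteq> e3" using m[of 0 2] es by (auto simp: dominates_path4)
  moreover have "c0 \<noteq> e4" using m[of 1 3] es by (auto simp: dominates_path4 numeral_3_eq_3)
  moreover have "e3 \<noteq> e4" using m[of 2 3] es by (auto simp: dominates_path4 numeral_3_eq_3 numeral_2_eq_2)
  ultimately have "card (set es) = 3" using es by simp
  moreover have "card (set es) \<le> 2"
    using comp V(2) s(1) opt2 unfolding strictly_competitive_def by fastforce
  ultimately show False by simp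
qed

end

theory Submission
  imports Defs
begin

text \<open>
  The oracle fixes an optimal coloring with colors \<open>0, \<dots>, Opt - 1\<close>, renamed so that the first
  request has color 0 and hence needs no advice. With \<open>b = \<lceil>log Opt\<rceil>\<close>, the tape starts with \<open>b\<close> in
  unary (\<open>b + 1\<close> bits), followed by \<open>b\<close> bits for the color of each of the remaining \<open>n - 1\<close>
  requests. These are \<open>n b + 1\<close> bits, which is at most \<open>(n + 1) b\<close> if \<open>b \<ge> 1\<close>, and 1 if \<open>Opt = 1\<close>.
  Without the saving on the first request the total would exceed the bound by one bit.
\<close>

text \<open>The continuation receives the cell of the first zero. This is the number encoded in
  unary because the scheme starts reading at cell 0. Corecursion is required since a tape of ones
  alone never stops the search.\<close>

primcorec read_unary :: "nat \<Rightarrow> (nat \<Rightarrow> computation) \<Rightarrow> computation" where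
  "read_unary p k = Query p (\<lambda>x. if x then read_unary (Suc p) k else k p)"

primrec read_binary :: "nat \<Rightarrow> nat \<Rightarrow> (nat \<Rightarrow> computation) \<Rightarrow> computation" where
  "read_binary p 0 k = k 0"
| "read_binary p (Suc n) k =
     Query p (\<lambda>x. read_binary (Suc p) n (\<lambda>m. k (of_bool x + 2 * m)))"

lemma computes_read_unary:
  assumes "computes \<phi> (k (p + n)) c R" and "\<And>i. i < n \<Longrightarrow> \<phi> (p + i)" and "\<not> \<phi> (p + n)"
  shows "computes \<phi> (read_unary p k) c (R \<union> {Suc p..Suc (p + n)})"
  using assms
proof (induction n arbitrary: p)
  case 0
  then have "computes \<phi> (if \<phi> p then read_unary (Suc p) k else k p) c R" by simp
  from computes.query[where f = "\<lambda>x. if x then read_unary (Suc p) k else k p", OF this]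
  show ?case by (subst read_unary.code) simp
next
  case (Suc n)
  have "\<phi> (Suc p + i)" if "i < n" for i using Suc.prems(2)[of "Suc i"] that by simp
  then have "computes \<phi> (read_unary (Suc p) k) c (R \<union> {Suc (Suc p)..Suc (Suc p + n)})"
    using Suc.IH[of "Suc p"] Suc.prems by simp
  moreover have "\<phi> p" using Suc.prems(2)[of 0] by simp
  ultimately have "computes \<phi> (if \<phi> p then read_unary (Suc p) k else k p) c
      (R \<union> {Suc (Suc p)..Suc (Suc p + n)})" by simp
  from computes.query[where f = "\<lambda>x. if x then read_unary (Suc p) k else k p", OF this]
  have "computes \<phi> (read_unary p k) c (insert (Suc p) (R \<union> {Suc (Suc p)..Suc (Suc p + n)}))"
    by (subst read_unary.code)
  moreover have "insert (Suc p) (R \<union> {Suc (Suc p)..Suc (Suc p + n)}) = R \<union> {Suc p..Suc (p + Suc n)}"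
    by auto
  ultimately show ?case by metis
qed

text \<open>The least significant bit comes first, so each query splits \<open>m\<close> into its
  parity and \<open>m div 2\<close>, and the factor 2 moves into the continuation. The bound
  \<open>m < 2 ^ n\<close> ensures that nothing of \<open>m\<close> is left after \<open>n\<close>
  bits.\<close>

lemma computes_read_binary:
  assumes "computes \<phi> (k m) c R" and "m < 2 ^ n" and "\<And>i. i < n \<Longrightarrow> \<phi> (p + i) = bit m i"
  shows "computes \<phi> (read_binary p n k) c (R \<union> {Suc p..p + n})"
  using assms
proof (induction n arbitrary: p k m)
  case 0
  then show ?case by simp
next
  case (Suc n)
  have "\<phi> p = odd m" using Suc.prems(3)[of 0] by (simp add: bit_0)
  then have "computes \<phi> (k (of_bool (\<phi> p) + 2 * (m div 2))) c R"
    using Suc.prems(1) by simp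
  moreover have "\<phi> (Suc p + i) = bit (m div 2) i" if "i < n" for i
    using Suc.prems(3)[of "Suc i"] that by (simp add: bit_Suc)
  ultimately have "computes \<phi> (read_binary (Suc p) n (\<lambda>m. k (of_bool (\<phi> p) + 2 * m))) c
      (R \<union> {Suc (Suc p)..Suc p + n})"
    using Suc.prems(2) by (intro Suc.IH[of _ "m div 2"]) auto
  from computes.query[where f = "\<lambda>x. read_binary (Suc p) n (\<lambda>m. k (of_bool x + 2 * m))", OF this]
  have "computes \<phi> (read_binary p (Suc n) k) c (insert (Suc p) (R \<union> {Suc (Suc p)..Suc p + n}))"
    by simp
  moreover have "insert (Suc p) (R \<union> {Suc (Suc p)..Suc p + n}) = R \<union> {Suc p..p + Suc n}"
    by auto
  ultimately show ?case by metis
qed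

text \<open>An algorithm keeps no memory between requests, so a run can be checked separately on
  each prefix.\<close>

lemma serves_computes:
  assumes "length cs = length I"
    and "\<And>j. j < length I \<Longrightarrow> computes \<phi> (A (take (Suc j) I)) (cs ! j) (S j)"
  shows "serves A \<phi> I cs (\<Union>j<length I. S j)"
  using assms
proof (induction I arbitrary: cs rule: rev_induct)
  case Nil
  then show ?case by (simp add: serves.empty)
next
  case (snoc v I)
  from snoc.prems(1) obtain ds c where cs: "cs = ds @ [c]" "length ds = length I"
    by (metis length_append_singleton length_Suc_conv_rev)
  have "computes \<phi> (A (take (Suc j) I)) (ds ! j) (S j)" if "j < length I" for j
    using snoc.prems(2)[of j] that cs by (simp add: nth_append)
  then have "serves A \<phi> I ds (\<Union>j<length I. S j)" using snoc.IH cs by blast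
  moreover have "computes \<phi> (A (I @ [v])) c (S (length I))"
    using snoc.prems(2)[of "length I"] cs by (simp add: nth_append)
  ultimately have "serves A \<phi> (I @ [v]) (ds @ [c]) ((\<Union>j<length I. S j) \<union> S (length I))"
    by (rule serves.request)
  then show ?case using cs by (simp add: lessThan_Suc Un_commute)
qed

lemma is_multicoloring_map:
  assumes "is_multicoloring G I cs" and "inj_on f (set cs)" and "\<And>c. c \<in> set cs \<Longrightarrow> 0 < f c"
  shows "is_multicoloring G I (map f cs)"
  using assms unfolding is_multicoloring_def
  by (auto simp: inj_on_eq_iff)

text \<open>Color names are immaterial: an optimal coloring stays optimal under any injective
  renaming, and one can be chosen that sends the color of the first request to 0.\<close>

lemma optimal_coloring_first_0:
  "\<exists>ds. is_multicoloring G I (map Suc ds) \<and> set ds = {..<Opt G I} \<and> (I \<noteq> [] \<longrightarrow> ds ! 0 = 0)"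
proof -
  obtain cs where cs: "is_multicoloring G I cs" "card (set cs) = Opt G I"
    using Opt_attained by blast
  have len: "length cs = length I" using cs(1) by (simp add: is_multicoloring_def)
  show ?thesis
  proof (cases "I = []")
    case True
    then show ?thesis using cs len by (intro exI[of _ "[]"]) auto
  next
    case False
    then have hd: "cs ! 0 \<in> set cs" using len by simp
    let ?k = "Opt G I"
    have "?k > 0" using cs(2) hd by (metis card_gt_0_iff empty_iff finite_set)
    have "card (set cs - {cs ! 0}) = card {1..<?k}" using cs(2) hd by simp
    then obtain f where f: "bij_betw f (set cs - {cs ! 0}) {1..<?k}"
      using finite_same_card_bij[of "set cs - {cs ! 0}" "{1..<?k}"] by blast
    define g where "g = (\<lambda>c. if c = cs ! 0 then 0 else f c)"
    have "g ` set cs = insert 0 (f ` (set cs - {cs ! 0}))"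
      using hd by (force simp: g_def)
    also have "\<dots> = {..<?k}" using f \<open>?k > 0\<close> by (auto simp: bij_betw_def)
    finally have gim: "g ` set cs = {..<?k}" .
    \<comment> \<open>Domain and image both have \<open>Opt G I\<close> elements, so injectivity
      follows by counting.\<close>
    then have ginj: "inj_on g (set cs)" using cs(2) by (intro eq_card_imp_inj_on) auto
    have "is_multicoloring G I (map (Suc \<circ> g) cs)"
      using cs(1) ginj by (intro is_multicoloring_map) (auto simp: comp_inj_on)
    then show ?thesis using gim hd len False
      by (intro exI[of _ "map g cs"]) (auto simp: g_def)
  qed
qed

text \<open>This makes the binary blocks wide enough for all colors below \<open>k\<close>.\<close>

lemma le_two_power_ceiling_log: "k \<le> 2 ^ nat \<lceil>log 2 (real k)\<rceil>"
proof (cases "k = 0")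
  case False
  then have "log 2 (real k) \<ge> 0" by simp
  then have "log 2 (real k) \<le> real (nat \<lceil>log 2 (real k)\<rceil>)" by linarith
  then have "real k \<le> 2 powr real (nat \<lceil>log 2 (real k)\<rceil>)"
    using False by (subst (asm) log_le_iff) auto
  then have "real k \<le> real (2 ^ nat \<lceil>log 2 (real k)\<rceil>)" by (simp add: powr_realpow)
  then show ?thesis by (simp only: of_nat_le_iff)
qed simp

text \<open>Every request after the first rereads \<open>b\<close>. The offset
  \<open>length J - 2\<close> counts the blocks of earlier requests, as the first request has none,
  and \<open>Suc\<close> makes the colors positive.\<close>

definition advised_coloring :: "'v online_algorithm" where
  "advised_coloring J =
     (if length J = 1 then Assign 1
      else read_unary 0 (\<lambda>b. read_binary (Suc b + (length J - 2) * b) b (\<lambda>m. Assign (Suc m))))"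

text \<open>Cell \<open>b\<close> holds the zero that ends the unary part. The \<open>Suc\<close> in
  the list index skips the first request. Bits beyond the last block are arbitrary and never
  read.\<close>

definition advice_tape :: "nat \<Rightarrow> nat list \<Rightarrow> tape" where
  "advice_tape b ds i =
     (if i \<le> b then i < b else bit (ds ! Suc ((i - Suc b) div b)) ((i - Suc b) mod b))"

text \<open>The conjunct \<open>I \<noteq> []\<close> under the quantifier over \<open>R\<close>
  records that the empty sequence reads no bit, where the numerical bound alone would allow
  one.\<close>

lemma serves_advised_coloring:
  assumes len: "length ds = length I" and bound: "\<And>d. d \<in> set ds \<Longrightarrow> d < 2 ^ b"
    and first: "I \<noteq> [] \<Longrightarrow> ds ! 0 = 0"
  shows "\<exists>R. serves advised_coloring (advice_tape b ds) I (map Suc ds) R \<and>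
    (\<forall>r\<in>R. I \<noteq> [] \<and> r \<le> Suc (length I * b))"
proof -
  let ?\<phi> = "advice_tape b ds"
  \<comment> \<open>The first cell of the block of request \<open>j\<close>, for
    \<open>j > 0\<close>.\<close>
  let ?p = "\<lambda>j. Suc b + (j - 1) * b"
  define S where "S j = (if j = 0 then {} else {Suc (?p j)..?p j + b} \<union> {Suc 0..Suc b})" for j
  have "computes ?\<phi> (advised_coloring (take (Suc j) I)) (map Suc ds ! j) (S j)"
    if j: "j < length I" for j
  proof (cases "j = 0")
    case True
    then have "length (take (Suc j) I) = 1" using j by (simp add: min_absorb2 Suc_leI)
    then show ?thesis using True j first len
      by (auto simp: advised_coloring_def S_def simp del: length_take intro: computes.assign)
  next
    case False
    have "?\<phi> (?p j + i) = bit (ds ! j) i" if "i < b" for i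
    proof -
      have "?p j + i - Suc b = (j - 1) * b + i" by simp
      moreover have "((j - 1) * b + i) div b = j - 1" "((j - 1) * b + i) mod b = i"
        using that by auto
      ultimately show ?thesis using False by (simp add: advice_tape_def)
    qed
    moreover have "ds ! j < 2 ^ b" using bound j len by simp
    ultimately have "computes ?\<phi> (read_binary (?p j) b (\<lambda>m. Assign (Suc m))) (Suc (ds ! j))
        ({} \<union> {Suc (?p j)..?p j + b})"
      by (intro computes_read_binary[where m = "ds ! j"] computes.assign) auto
    \<comment> \<open>The unary zero stands in cell \<open>b\<close>, so the continuation runs with
      the true block length.\<close>
    then have "computes ?\<phi>
        (read_unary 0 (\<lambda>b. read_binary (Suc b + (j - 1) * b) b (\<lambda>m. Assign (Suc m))))
        (Suc (ds ! j)) (({} \<union> {Suc (?p j)..?p j + b}) \<union> {Suc 0..Suc (0 + b)})"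
      by (intro computes_read_unary) (auto simp: advice_tape_def)
    moreover have "length (take (Suc j) I) = Suc j" using j by simp
    moreover have "Suc j - 2 = j - 1" by simp
    ultimately show ?thesis using False j len
      by (simp add: advised_coloring_def S_def)
  qed
  then have "serves advised_coloring ?\<phi> I (map Suc ds) (\<Union>j<length I. S j)"
    using len by (intro serves_computes) auto
  moreover have "r \<le> Suc (length I * b)" if "j < length I" "r \<in> S j" for j r
  proof -
    have "j \<noteq> 0" using that by (auto simp: S_def split: if_splits)
    \<comment> \<open>The end of the block also dominates the unary part, whose last index is
      \<open>Suc b\<close>.\<close>
    then have "r \<le> ?p j + b" using that by (auto simp: S_def)
    also have "?p j + b = Suc (Suc j * b)" using \<open>j \<noteq> 0\<close> by (cases j) auto
    also have "\<dots> \<le> Suc (length I * b)"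
      using that(1) mult_le_mono1[of "Suc j" "length I" b] by simp
    finally show ?thesis .
  qed
  ultimately show ?thesis by fastforce
qed

theorem theorem8:
  fixes G :: "('v, 'e) pre_digraph"
  assumes "sym_digraph G" and "loopfree_digraph G" and "nomulti_digraph G"
  shows "\<exists>(A :: 'v online_algorithm) (\<Omega> :: 'v advice_oracle).
    solves_multicoloring G A \<Omega> \<and>
    strictly_competitive 1 G A \<Omega> \<and>
    (\<forall>I cs R. set I \<subseteq> verts G \<longrightarrow> serves A (\<Omega> I) I cs R \<longrightarrow>
       (Opt G I \<noteq> 1 \<longrightarrow>
          int (max_index R) \<le> (int (length I) + 1) * \<lceil>log 2 (real (Opt G I))\<rceil>) \<and>
       (Opt G I = 1 \<longrightarrow> max_index R \<le> 1))"
proof -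
  define b where "b I = nat \<lceil>log 2 (real (Opt G I))\<rceil>" for I
  obtain ds where ds: "\<And>I. is_multicoloring G I (map Suc (ds I))"
      "\<And>I. set (ds I) = {..<Opt G I}" "\<And>I. I \<noteq> [] \<Longrightarrow> ds I ! 0 = 0"
    using optimal_coloring_first_0[of G] by metis
  define \<Omega> where "\<Omega> I = advice_tape (b I) (ds I)" for I
  have "\<exists>R. serves advised_coloring (\<Omega> I) I (map Suc (ds I)) R \<and>
      (\<forall>r\<in>R. I \<noteq> [] \<and> r \<le> Suc (length I * b I))" for I
    unfolding \<Omega>_def
  proof (rule serves_advised_coloring)
    show "length (ds I) = length I" using ds(1)[of I] by (simp add: is_multicoloring_def)
    show "d < 2 ^ b I" if "d \<in> set (ds I)" for d
      using that ds(2)[of I] le_two_power_ceiling_log[of "Opt G I"] by (simp add: b_def)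
  qed (rule ds(3))
  then obtain R where R: "\<And>I. serves advised_coloring (\<Omega> I) I (map Suc (ds I)) (R I)"
      "\<And>I r. r \<in> R I \<Longrightarrow> I \<noteq> [] \<and> r \<le> Suc (length I * b I)"
    by metis
  have card: "card (set (map Suc (ds I))) = Opt G I" for I
    using ds(2)[of I] by (simp add: card_image)
  \<comment> \<open>The claims quantify over all runs; determinism reduces them to the run
    constructed here.\<close>
  have unique: "cs = map Suc (ds I) \<and> T = R I" if "serves advised_coloring (\<Omega> I) I cs T" for I cs T
    using serves_deterministic[OF R(1) that] .
  have fin: "finite (R I)" for I using finite_serves[OF R(1)] .
  have max_le: "max_index (R I) \<le> Suc (length I * b I)" for I
    using fin R(2) by (auto simp: max_index_def)
  have b0: "\<lceil>log 2 (real (Opt G I))\<rceil> = int (b I)" for I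
  proof -
    \<comment> \<open>For \<open>Opt G I = 0\<close> this rests on the default value
      \<open>ln 0 = 0\<close>.\<close>
    have "0 \<le> log 2 (real (Opt G I))" by (cases "Opt G I = 0") (auto simp: log_def)
    then have "0 \<le> \<lceil>log 2 (real (Opt G I))\<rceil>" by linarith
    then show ?thesis by (simp add: b_def)
  qed
  have "int (max_index (R I)) \<le> (int (length I) + 1) * int (b I)" if "Opt G I \<noteq> 1" for I
  proof (cases "I = []")
    case True
    then have "R I = {}" using R(2) by blast
    then show ?thesis by (simp add: max_index_def)
  next
    case False
    have "ds I \<noteq> []" using False ds(1)[of I] by (auto simp: is_multicoloring_def)
    then have "Opt G I \<noteq> 0" using ds(2)[of I] by (metis lessThan_0 set_empty)
    with that have "Opt G I \<ge> 2" by linarith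
    moreover have "Opt G I \<le> 2 ^ b I" unfolding b_def by (rule le_two_power_ceiling_log)
    \<comment> \<open>With \<open>b I \<ge> 1\<close>, the one bit beyond
      \<open>length I * b I\<close> fits into the extra summand \<open>b I\<close>.\<close>
    ultimately have "b I \<noteq> 0" by (intro notI) simp
    then have "Suc (length I * b I) \<le> (length I + 1) * b I" by simp
    with max_le[of I] have "max_index (R I) \<le> (length I + 1) * b I" by linarith
    then have "int (max_index (R I)) \<le> int ((length I + 1) * b I)" by (simp only: of_nat_le_iff)
    then show ?thesis by (simp add: algebra_simps)
  qed
  \<comment> \<open>Here \<open>b I = 0\<close>: the blocks are empty and only the unary zero can be
    read.\<close>
  moreover have "max_index (R I) \<le> 1" if "Opt G I = 1" for I
    using max_le[of I] that by (simp add: b_def)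
  moreover have "solves_multicoloring G advised_coloring \<Omega>"
    unfolding solves_multicoloring_def using R(1) ds(1) by blast
  moreover have "strictly_competitive 1 G advised_coloring \<Omega>"
    unfolding strictly_competitive_def
  proof (intro allI impI)
    fix I cs T assume "serves advised_coloring (\<Omega> I) I cs T"
    then have "cs = map Suc (ds I)" using unique by blast
    then show "real (card (set cs)) \<le> 1 * real (Opt G I)" using card[of I] by simp
  qed
  ultimately show ?thesis
    unfolding b0 by (intro exI[of _ advised_coloring] exI[of _ \<Omega>]) (blast dest: unique)
qed

end
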